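(* Let $\phi = \frac{1+\sqrt{5}}{2}$. For every positive integer $n$, we have $L(n) < L(n+1)$ if and only if $$n \in S_1 := \left\{\left\lfloor \frac{k+1}{\phi}\right\rfloor + 2k \,:\, k \in \mathbb{Z},\ k\ge 1\right\},$$ and we have $L(n) > L(n+1)$ if and only if $$n \in S_2 := \left\{2\left\lfloor \frac{k+1}{\phi}\right\rfloor + 3k - 1 \,:\, k \in \mathbb{Z},\ k\ge 1\right\}.$$
   Context: The Fibonacci sequence is defined by $F_0 = 0$, $F_1 = 1$, and $F_n = F_{n-1}+F_{n-2}$ for $n\ge 2$. By Zeckendorf's theorem, every positive integer $n$ can be written uniquely as $n = \sum_{i=1}^{k} F_{c_i}$ with $k \ge 1$, $c_1\ge 2$, and $c_i \ge c_{i-1}+2$ for $2\le i\le k$; this is the Zeckendorf partition of $n$. Let $P(n)=\{F_{c_1},\dots,F_{c_k}\}$ be the set of Fibonacci numbers in the Zeckendorf partition of $n$, and let $L(n) := \#P(n) = k$ be the number of summands. *)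

theory Defs
  imports Complex_Main "HOL-Number_Theory.Fib"
begin

(* The list cs = [c_1, ..., c_k] consists of the indices of the Zeckendorf partition of n;
   positions are counted from 0, so cs ! i is c_(i+1). *)
definition is_zeckendorf :: "nat list \<Rightarrow> nat \<Rightarrow> bool" where
  "is_zeckendorf cs n \<longleftrightarrow>
     length cs \<ge> 1 \<and> cs ! 0 \<ge> 2 \<and>
     (\<forall>i. Suc i < length cs \<longrightarrow> cs ! Suc i \<ge> cs ! i + 2) \<and>
     n = (\<Sum>i<length cs. fib (cs ! i))"

(* Meaningful for n > 0 only; the partition is then unique by Zeckendorf's theorem, see
   zeckendorf_ex1 below. *)
definition zeckendorf_indices :: "nat \<Rightarrow> nat list" where
  "zeckendorf_indices n = (THE cs. is_zeckendorf cs n)"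

definition P :: "nat \<Rightarrow> nat set" where
  "P n = fib ` set (zeckendorf_indices n)"

definition L :: "nat \<Rightarrow> nat" where
  "L n = card (P n)"

definition phi :: real where
  "phi = (1 + sqrt 5) / 2"

definition S\<^sub>1 :: "int set" where
  "S\<^sub>1 = {\<lfloor>(real_of_int k + 1) / phi\<rfloor> + 2 * k | k :: int. k \<ge> 1}"

definition S\<^sub>2 :: "int set" where
  "S\<^sub>2 = {2 * \<lfloor>(real_of_int k + 1) / phi\<rfloor> + 3 * k - 1 | k :: int. k \<ge> 1}"

lemma is_zeckendorf_Nil: "\<not> is_zeckendorf [] n"
  by (simp add: is_zeckendorf_def)

lemma is_zeckendorf_single: "is_zeckendorf [c] n \<longleftrightarrow> c \<ge> 2 \<and> n = fib c"
  by (auto simp: is_zeckendorf_def)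

lemma is_zeckendorf_snoc:
  assumes "cs \<noteq> []"
  shows "is_zeckendorf (cs @ [c]) n \<longleftrightarrow>
    (\<exists>m. is_zeckendorf cs m \<and> n = m + fib c \<and> c \<ge> last cs + 2)"
proof -
  have len: "length cs \<ge> 1" using assms by (cases cs) auto
  have gaps: "(\<forall>i. Suc i < length (cs @ [c]) \<longrightarrow> (cs @ [c]) ! Suc i \<ge> (cs @ [c]) ! i + 2) \<longleftrightarrow>
     (\<forall>i. Suc i < length cs \<longrightarrow> cs ! Suc i \<ge> cs ! i + 2) \<and> c \<ge> last cs + 2" (is "?A \<longleftrightarrow> ?B")
  proof
    assume a: ?A
    have "cs ! Suc i \<ge> cs ! i + 2" if "Suc i < length cs" for i
      using a[rule_format, of i] that by (simp add: nth_append)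
    moreover have "c \<ge> last cs + 2"
      using a[rule_format, of "length cs - 1"] len assms by (simp add: nth_append last_conv_nth)
    ultimately show ?B by blast
  next
    assume b: ?B
    show ?A
    proof (intro allI impI)
      fix i assume i: "Suc i < length (cs @ [c])"
      show "(cs @ [c]) ! Suc i \<ge> (cs @ [c]) ! i + 2"
      proof (cases "Suc i < length cs")
        case True
        then show ?thesis using b by (simp add: nth_append)
      next
        case False
        then have "i = length cs - 1" "Suc i = length cs" using i by auto
        then show ?thesis using b assms by (simp add: nth_append last_conv_nth)
      qed
    qed
  qed
  have s: "(\<Sum>i<length (cs @ [c]). fib ((cs @ [c]) ! i)) = (\<Sum>i<length cs. fib (cs ! i)) + fib c"
    by (simp add: nth_append)
  have z: "(cs @ [c]) ! 0 = cs ! 0" using assms by (simp add: nth_append)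
  show ?thesis
    unfolding is_zeckendorf_def gaps s z using len by auto
qed

lemma is_zeckendorf_last:
  "is_zeckendorf cs n \<Longrightarrow> last cs \<ge> 2 \<and> fib (last cs) \<le> n \<and> n < fib (Suc (last cs))"
proof (induction cs arbitrary: n rule: rev_induct)
  case Nil
  then show ?case by (simp add: is_zeckendorf_Nil)
next
  case (snoc c cs)
  show ?case
  proof (cases "cs = []")
    case True
    then have c: "c \<ge> 2" "n = fib c" using snoc.prems by (auto simp: is_zeckendorf_single)
    then obtain d where "c = Suc (Suc d)" by (metis Suc_diff_Suc add_2_eq_Suc le_Suc_ex)
    then show ?thesis using c True by (simp add: fib_neq_0_nat)
  next
    case False
    then obtain m where m: "is_zeckendorf cs m" "n = m + fib c" "c \<ge> last cs + 2"
      using snoc.prems is_zeckendorf_snoc by blast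
    then have l: "m < fib (Suc (last cs))" using snoc.IH by blast
    obtain d where d: "c = Suc d" using m(3) by (cases c) auto
    have "fib (Suc (last cs)) \<le> fib d" using m(3) d by (intro fib_mono) simp
    then show ?thesis using m d l by simp
  qed
qed

lemma fib_interval_unique:
  assumes "fib a \<le> n" "n < fib (Suc a)" "fib b \<le> n" "n < fib (Suc b)"
  shows "a = b"
proof (rule ccontr)
  assume "a \<noteq> b"
  then have "Suc a \<le> b \<or> Suc b \<le> a" by auto
  then have "fib (Suc a) \<le> fib b \<or> fib (Suc b) \<le> fib a" using fib_mono by blast
  then show False using assms by auto
qed

lemma is_zeckendorf_unique:
  "is_zeckendorf cs n \<Longrightarrow> is_zeckendorf ds n \<Longrightarrow> cs = ds"
proof (induction cs arbitrary: n ds rule: rev_induct)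
  case Nil
  then show ?case by (simp add: is_zeckendorf_Nil)
next
  case (snoc c cs)
  obtain es e where ds: "ds = es @ [e]"
    using snoc.prems(2) is_zeckendorf_Nil by (metis rev_exhaust)
  have "c = e"
    using is_zeckendorf_last[OF snoc.prems(1)] is_zeckendorf_last[OF snoc.prems(2)]
      fib_interval_unique[of c n e] by (simp add: ds)
  have pos: "m > 0" if "is_zeckendorf xs m" for xs m
    using is_zeckendorf_last[OF that] fib_neq_0_nat[of "last xs"] by simp
  show ?case
  proof (cases "cs = []")
    case True
    then have n: "n = fib c" using snoc.prems(1) by (simp add: is_zeckendorf_single)
    have "es = []"
    proof (rule ccontr)
      assume "es \<noteq> []"
      then obtain m where "is_zeckendorf es m" "n = m + fib e"
        using snoc.prems(2) is_zeckendorf_snoc unfolding ds by blast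
      then show False using pos n \<open>c = e\<close> by fastforce
    qed
    then show ?thesis using True ds \<open>c = e\<close> by simp
  next
    case False
    then obtain m where m: "is_zeckendorf cs m" "n = m + fib c"
      using snoc.prems(1) is_zeckendorf_snoc by blast
    have "es \<noteq> []"
      using snoc.prems(2) m pos[OF m(1)] \<open>c = e\<close> by (auto simp: ds is_zeckendorf_single)
    then obtain m' where m': "is_zeckendorf es m'" "n = m' + fib e"
      using snoc.prems(2) is_zeckendorf_snoc unfolding ds by blast
    then have "m' = m" using m \<open>c = e\<close> by simp
    then show ?thesis using snoc.IH m m' ds \<open>c = e\<close> by blast
  qed
qed

lemma fib_interval_exists:
  "n > 0 \<Longrightarrow> \<exists>c\<ge>2. fib c \<le> n \<and> n < fib (Suc c)"
proof (induction n)
  case 0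
  then show ?case by simp
next
  case (Suc n)
  show ?case
  proof (cases "n = 0")
    case True
    have "fib (Suc 2) = 2" by (simp add: numeral_2_eq_2)
    then show ?thesis using True by (intro exI[of _ 2]) simp
  next
    case False
    then obtain c where c: "c \<ge> 2" "fib c \<le> n" "n < fib (Suc c)" using Suc.IH by auto
    show ?thesis
    proof (cases "Suc n < fib (Suc c)")
      case True
      then show ?thesis using c by (intro exI[of _ c]) simp
    next
      case False
      then have "Suc n = fib (Suc c)" using c by simp
      moreover have "fib c > 0" using c by (intro fib_neq_0_nat) simp
      ultimately show ?thesis using c by (intro exI[of _ "Suc c"]) simp
    qed
  qed
qed

lemma is_zeckendorf_exists: "n > 0 \<Longrightarrow> \<exists>cs. is_zeckendorf cs n"
proof (induction n rule: less_induct)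
  case (less n)
  obtain c where c: "c \<ge> 2" "fib c \<le> n" "n < fib (Suc c)"
    using fib_interval_exists less.prems by blast
  show ?case
  proof (cases "n = fib c")
    case True
    then have "is_zeckendorf [c] n" using c by (simp add: is_zeckendorf_single)
    then show ?thesis by blast
  next
    case False
    have "fib c > 0" using c by (intro fib_neq_0_nat) simp
    then obtain cs where cs: "is_zeckendorf cs (n - fib c)"
      using less.IH[of "n - fib c"] c False by auto
    have ne: "cs \<noteq> []" using cs is_zeckendorf_Nil by blast
    obtain d where d: "c = Suc d" using c(1) by (cases c) auto
    have "fib (last cs) < fib d"
      using is_zeckendorf_last[OF cs] c d by (simp, linarith)
    then have "last cs < d" using fib_mono by (meson leD leI)
    then have "is_zeckendorf (cs @ [c]) n"
      using cs c d ne by (auto simp: is_zeckendorf_snoc[OF ne] intro!: exI[of _ "n - fib c"])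
    then show ?thesis by blast
  qed
qed

theorem zeckendorf_ex1: "n > 0 \<Longrightarrow> \<exists>!cs. is_zeckendorf cs n"
  using is_zeckendorf_exists is_zeckendorf_unique by blast

lemma is_zeckendorf_zeckendorf_indices:
  "n > 0 \<Longrightarrow> is_zeckendorf (zeckendorf_indices n) n"
  unfolding zeckendorf_indices_def by (rule theI') (rule zeckendorf_ex1)

end

theory Submission
  imports Defs
begin

text \<open>
  Both comparisons are decided by the least index \<open>c\<close> in the Zeckendorf partition of \<open>n + 1\<close>.
  Subtracting 1 leaves all other summands alone and replaces \<open>F\<^sub>c\<close> by
  \<open>F\<^sub>c - 1 = F\<^bsub>c-1\<^esub> + F\<^bsub>c-3\<^esub> + \<dots>\<close>, a sum (empty for \<open>c = 2\<close>) that ends with \<open>F\<^sub>2\<close> or \<open>F\<^sub>3\<close> and has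
  \<open>\<lfloor>(c - 1) / 2\<rfloor>\<close> terms.  Hence \<open>L n + 1 = L (n + 1) + \<lfloor>(c - 1) / 2\<rfloor>\<close> (\<open>L_pred\<close>), so that
  \<open>L n < L (n + 1)\<close> means \<open>c = 2\<close>, and \<open>L n > L (n + 1)\<close> means \<open>c \<ge> 5\<close>.
  When \<open>c = 2\<close>, removing \<open>F\<^sub>2 = 1\<close> shows that all indices of \<open>n\<close> itself are at least 4.

  It remains to enumerate the numbers all of whose indices are at least \<open>j + 2\<close>, for \<open>j = 2\<close>
  (giving \<open>n\<close>) and \<open>j = 3\<close> (giving \<open>n + 1\<close>).  They arise from the positive integers \<open>k\<close> by
  raising every index of \<open>k\<close> by \<open>j\<close>.  Raising by one nearly multiplies by \<open>\<phi>\<close>: the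
  error is \<open>\<Sum> (-1/\<phi>)\<^bsup>c\<^esup>\<close> over the indices \<open>c\<close> of \<open>k\<close>, and the gap condition confines
  it to the interval \<open>(-1/\<phi>\<^sup>2, 1/\<phi>)\<close> of length exactly 1.  So the raised number
  is \<open>k + \<lfloor>(k + 1) / \<phi>\<rfloor>\<close> (\<open>floor_shift\<close>), and the addition law for Fibonacci numbers
  turns this into \<open>F\<^sub>j \<lfloor>(k + 1) / \<phi>\<rfloor> + F\<^bsub>j+1\<^esub> k\<close> for a shift by \<open>j\<close>
  (\<open>spaced_fib_sum_iff_floor\<close>).
\<close>

section \<open>Zeckendorf partitions as spaced lists\<close>

text \<open>
  The lower bound on the head is a parameter because both recursion over the list and
  shifting all indices change it.
\<close>

fun spaced :: "nat \<Rightarrow> nat list \<Rightarrow> bool" where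
  "spaced b [] \<longleftrightarrow> True"
| "spaced b (c # cs) \<longleftrightarrow> b \<le> c \<and> spaced (c + 2) cs"

lemma spaced_mono: "spaced b cs \<Longrightarrow> a \<le> b \<Longrightarrow> spaced a cs"
  by (cases cs) auto

lemma spaced_ge: "spaced b cs \<Longrightarrow> c \<in> set cs \<Longrightarrow> b \<le> c"
  by (induction cs arbitrary: b) fastforce+

lemma spaced_map_add: "spaced (b + j) (map (\<lambda>c. c + j) cs) \<longleftrightarrow> spaced b cs"
proof (induction cs arbitrary: b)
  case (Cons c cs)
  show ?case using Cons.IH[of "c + 2"] by (simp add: ac_simps)
qed simp

lemma spaced_distinct: "spaced b cs \<Longrightarrow> distinct cs"
proof (induction cs arbitrary: b)
  case (Cons c cs)
  then show ?case using spaced_ge[of "c + 2" cs c] by auto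
qed simp

lemma spaced_iff_nth:
  "spaced b cs \<longleftrightarrow> (cs \<noteq> [] \<longrightarrow> b \<le> cs ! 0) \<and>
     (\<forall>i. Suc i < length cs \<longrightarrow> cs ! i + 2 \<le> cs ! Suc i)"
proof (induction cs arbitrary: b)
  case (Cons c cs)
  have "(\<forall>i. Suc i < length (c # cs) \<longrightarrow> (c # cs) ! i + 2 \<le> (c # cs) ! Suc i) \<longleftrightarrow>
      (cs \<noteq> [] \<longrightarrow> c + 2 \<le> cs ! 0) \<and> (\<forall>i. Suc i < length cs \<longrightarrow> cs ! i + 2 \<le> cs ! Suc i)"
    by (simp add: All_less_Suc2 less_Suc_eq_0_disj) (cases cs; auto simp: nth_Cons split: nat.splits)
  then show ?case using Cons.IH[of "c + 2"] by auto
qed simp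

lemma is_zeckendorf_iff_spaced:
  "is_zeckendorf cs n \<longleftrightarrow> cs \<noteq> [] \<and> spaced 2 cs \<and> n = (\<Sum>c\<leftarrow>cs. fib c)"
proof -
  have "(\<Sum>c\<leftarrow>cs. fib c) = (\<Sum>i<length cs. fib (cs ! i))"
    by (simp add: sum_list_sum_nth atLeast0LessThan)
  then show ?thesis
    unfolding is_zeckendorf_def spaced_iff_nth by (cases cs) auto
qed

lemma inj_on_fib: "inj_on fib {2..}"
proof (rule inj_onI)
  have *: "fib a < fib (Suc a)" if "2 \<le> a" for a
  proof -
    obtain d where "a = Suc (Suc d)" using \<open>2 \<le> a\<close> by (metis add_2_eq_Suc le_Suc_ex)
    then show ?thesis by (simp add: fib_neq_0_nat)
  qed
  fix a b :: nat assume "a \<in> {2..}" "b \<in> {2..}" "fib a = fib b"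
  then show "a = b" using fib_interval_unique[of a "fib a" b] *[of a] *[of b] by simp
qed

lemma L_eq_length:
  assumes "is_zeckendorf cs n"
  shows "L n = length cs"
proof -
  have sp: "spaced 2 cs" using assms by (simp add: is_zeckendorf_iff_spaced)
  have "zeckendorf_indices n = cs"
    unfolding zeckendorf_indices_def using assms is_zeckendorf_unique by blast
  moreover have "inj_on fib (set cs)"
    by (rule inj_on_subset[OF inj_on_fib]) (use sp spaced_ge in auto)
  ultimately show ?thesis
    using spaced_distinct[OF sp] by (simp add: L_def P_def card_image distinct_card)
qed

section \<open>Subtracting one\<close>

text \<open>
  Since \<open>F\<^bsub>c+2\<^esub> = F\<^bsub>c+1\<^esub> + F\<^sub>c\<close>, the index \<open>c + 1\<close> may be moved into the untouched tail
  and the subtraction continued at \<open>c\<close>.  For this the tail need only start at \<open>c + 1\<close>, one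
  less than the gap condition provides.
\<close>

lemma spaced_fib_sum_pred:
  assumes "2 \<le> c" "spaced (c + 1) cs"
  shows "\<exists>ds. spaced 2 ds \<and> (\<Sum>d\<leftarrow>ds. fib d) + 1 = fib c + (\<Sum>d\<leftarrow>cs. fib d) \<and>
           length ds = length cs + (c - 1) div 2"
  using assms
proof (induction c arbitrary: cs rule: less_induct)
  case (less c)
  consider "c = 2" | "c = 3" | e where "c = e + 2" "2 \<le> e"
    using less.prems(1) that(3)[of "c - 2"] by linarith
  then show ?case
  proof cases
    case 1
    then show ?thesis using less.prems spaced_mono[of 3 cs 2] by (intro exI[of _ cs]) simp
  next
    case 2
    then show ?thesis using less.prems by (intro exI[of _ "2 # cs"]) (simp add: numeral_3_eq_3)
  next
    case 3
    have "spaced (e + 1) ((e + 1) # cs)" using less.prems 3 by simp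
    from less.IH[OF _ 3(2) this] 3(1) obtain ds where "spaced 2 ds"
      "(\<Sum>d\<leftarrow>ds. fib d) + 1 = fib e + (\<Sum>d\<leftarrow>(e + 1) # cs. fib d)"
      "length ds = length ((e + 1) # cs) + (e - 1) div 2" by auto
    then show ?thesis using 3 by (intro exI[of _ ds]) auto
  qed
qed

lemma L_pred:
  assumes "n > 0" "is_zeckendorf (c # cs) (n + 1)"
  shows "L n + 1 = L (n + 1) + (c - 1) div 2"
proof -
  have z: "2 \<le> c" "spaced (c + 1) cs" "n + 1 = fib c + (\<Sum>d\<leftarrow>cs. fib d)"
    using assms(2) spaced_mono[of "c + 2" cs "c + 1"] by (auto simp: is_zeckendorf_iff_spaced)
  from spaced_fib_sum_pred[OF z(1,2)] obtain ds where
    ds: "spaced 2 ds" "(\<Sum>d\<leftarrow>ds. fib d) = n" "length ds = length cs + (c - 1) div 2"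
    using z(3) by auto
  then have "is_zeckendorf ds n" using assms(1) by (auto simp: is_zeckendorf_iff_spaced)
  then show ?thesis using L_eq_length assms(2) ds(3) by fastforce
qed

section \<open>Raising all indices\<close>

lemma phi_gt_1: "phi > 1"
  by (simp add: phi_def)

lemma phi_square: "phi * phi = phi + 1"
  by (simp add: phi_def field_simps)

lemma phi_less_2: "phi < 2"
  by (simp add: phi_def real_less_lsqrt)

lemma conjugate_square: "(1 - phi) ^ 2 = 2 - phi"
  using phi_square by (simp add: power2_eq_square algebra_simps)

lemma conjugate_square_mult_bounds:
  assumes "-1 < x" "x < phi"
  shows "phi - 2 < (1 - phi) ^ 2 * x" "(1 - phi) ^ 2 * x < phi - 1"
proof -
  have "(2 - phi) * (-1) < (2 - phi) * x" "(2 - phi) * x < (2 - phi) * phi"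
    using assms phi_less_2 by (intro mult_strict_left_mono; simp)+
  then show "phi - 2 < (1 - phi) ^ 2 * x" "(1 - phi) ^ 2 * x < phi - 1"
    using phi_square by (auto simp: conjugate_square algebra_simps)
qed

lemma inverse_phi: "1 / phi = phi - 1"
  using phi_square phi_gt_1 by (simp add: field_simps)

text \<open>The conjugate \<open>1 - \<phi> = -1/\<phi>\<close> of \<open>\<phi>\<close> measures how far consecutive Fibonacci
  numbers are from having ratio \<open>\<phi>\<close>.\<close>

lemma fib_Suc_eq_phi: "real (fib (Suc c)) = phi * real (fib c) + (1 - phi) ^ c"
proof (induction c rule: fib.induct)
  case (3 c)
  have "(1 - phi) ^ Suc (Suc c) = (1 - phi) ^ 2 * (1 - phi) ^ c"
    by (simp add: power2_eq_square)
  also have "\<dots> = (1 - phi) ^ Suc c + (1 - phi) ^ c"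
    unfolding conjugate_square by (simp add: algebra_simps)
  finally have "(1 - phi) ^ Suc (Suc c) = (1 - phi) ^ Suc c + (1 - phi) ^ c" .
  with 3 show ?case by (simp add: algebra_simps)
qed auto

text \<open>
  Dividing out the power of the bound \<open>b\<close> makes one pair of bounds serve both parities of
  \<open>b\<close>.  They reproduce themselves: \<open>x \<mapsto> 1 + x/\<phi>\<^sup>2\<close> maps \<open>(-1, \<phi>)\<close> onto
  \<open>(1/\<phi>, \<phi>)\<close>, and a first index above \<open>b\<close> contributes at least one factor
  \<open>-1/\<phi>\<close>, which brings the absolute value below \<open>\<phi>/\<phi> = 1\<close>.
\<close>

lemma spaced_conjugate_sum_bounds:
  assumes "spaced b cs"
  shows "\<exists>x. -1 < x \<and> x < phi \<and> (\<Sum>c\<leftarrow>cs. (1 - phi) ^ c) = (1 - phi) ^ b * x"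
  using assms
proof (induction cs arbitrary: b)
  case Nil
  show ?case using phi_gt_1 by (intro exI[of _ 0]) simp
next
  case (Cons c cs)
  from Cons.prems have bc: "b \<le> c" and "spaced (c + 2) cs" by auto
  with Cons.IH obtain x where x: "-1 < x" "x < phi"
    "(\<Sum>c\<leftarrow>cs. (1 - phi) ^ c) = (1 - phi) ^ (c + 2) * x" by blast
  define y where "y = 1 + (1 - phi) ^ 2 * x"
  have y: "phi - 1 < y" "y < phi"
    using conjugate_square_mult_bounds[OF x(1,2)] by (auto simp: y_def)
  have sum: "(\<Sum>c\<leftarrow>c # cs. (1 - phi) ^ c) = (1 - phi) ^ b * ((1 - phi) ^ (c - b) * y)"
    using bc by (simp add: x(3) y_def power_add[symmetric] algebra_simps)
  have "-1 < (1 - phi) ^ (c - b) * y \<and> (1 - phi) ^ (c - b) * y < phi"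
  proof (cases "c - b")
    case 0
    then show ?thesis using y phi_gt_1 by simp
  next
    case (Suc i)
    have "\<bar>(1 - phi) ^ (c - b) * y\<bar> = (phi - 1) ^ i * ((phi - 1) * y)"
      using y phi_gt_1 by (simp add: Suc abs_mult power_abs)
    also have "\<dots> \<le> 1 * ((phi - 1) * y)"
      using y phi_gt_1 phi_less_2 by (intro mult_right_mono power_le_one) auto
    also have "\<dots> < (phi - 1) * phi"
      using y phi_gt_1 by simp
    also have "\<dots> = 1"
      using phi_square by (simp add: algebra_simps)
    finally show ?thesis using phi_gt_1 by linarith
  qed
  with sum show ?case by blast
qed

text \<open>
  With \<open>s\<close> and \<open>t\<close> the sums before and after the shift and \<open>e = t - \<phi> s\<close>, the relation
  \<open>1/\<phi> = \<phi> - 1\<close> gives \<open>(s + 1)/\<phi> = (t - s) + (\<phi> - 1 - e)\<close>.  The bounds on \<open>e\<close> put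
  the second summand strictly between 0 and 1.
\<close>

lemma floor_shift:
  assumes "spaced 2 cs"
  shows "\<lfloor>(real (\<Sum>c\<leftarrow>cs. fib c) + 1) / phi\<rfloor> =
           int (\<Sum>c\<leftarrow>cs. fib (Suc c)) - int (\<Sum>c\<leftarrow>cs. fib c)"
proof -
  define s t e where "s = (\<Sum>c\<leftarrow>cs. fib c)" and "t = (\<Sum>c\<leftarrow>cs. fib (Suc c))"
    and "e = (\<Sum>c\<leftarrow>cs. (1 - phi) ^ c)"
  have t: "real t = phi * real s + e"
    unfolding s_def t_def e_def
    by (induction cs) (simp_all add: fib_Suc_eq_phi algebra_simps del: fib.simps(3))
  obtain x where x: "-1 < x" "x < phi" "e = (1 - phi) ^ 2 * x"
    using spaced_conjugate_sum_bounds[OF assms] unfolding e_def by blast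
  have e: "phi - 2 < e" "e < phi - 1"
    using conjugate_square_mult_bounds[OF x(1,2)] by (auto simp: x(3))
  have "(real s + 1) / phi = (real s + 1) * (1 / phi)"
    by simp
  also have "\<dots> = real t - real s + (phi - 1 - e)"
    unfolding inverse_phi by (simp add: t algebra_simps)
  finally have "\<lfloor>(real s + 1) / phi\<rfloor> = int t - int s"
    using e by (intro floor_unique) auto
  then show ?thesis unfolding s_def t_def .
qed

text \<open>
  Lists with all indices at least \<open>j + 2\<close> are exactly the Zeckendorf partitions of positive
  integers \<open>k\<close> raised by \<open>j\<close>.
\<close>

lemma spaced_fib_sum_iff_floor:
  "(\<exists>ds. ds \<noteq> [] \<and> spaced (j + 2) ds \<and> m = (\<Sum>d\<leftarrow>ds. fib d)) \<longleftrightarrow>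
   (\<exists>k::int. k \<ge> 1 \<and>
      int m = int (fib j) * \<lfloor>(real_of_int k + 1) / phi\<rfloor> + int (fib (j + 1)) * k)"
  (is "?lhs \<longleftrightarrow> ?rhs")
proof -
  have fib_shift: "int (fib (c + j)) =
      int (fib j) * (int (fib (Suc c)) - int (fib c)) + int (fib (j + 1)) * int (fib c)" for c
    by (induction j rule: fib.induct) (simp_all add: algebra_simps)
  have value_shift: "int (\<Sum>c\<leftarrow>map (\<lambda>c. c + j) cs. fib c) =
      int (fib j) * \<lfloor>(real_of_int (int (\<Sum>c\<leftarrow>cs. fib c)) + 1) / phi\<rfloor> +
      int (fib (j + 1)) * int (\<Sum>c\<leftarrow>cs. fib c)" if "spaced 2 cs" for cs
  proof -
    have "int (\<Sum>c\<leftarrow>map (\<lambda>c. c + j) cs. fib c) =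
        int (fib j) * (int (\<Sum>c\<leftarrow>cs. fib (Suc c)) - int (\<Sum>c\<leftarrow>cs. fib c)) +
        int (fib (j + 1)) * int (\<Sum>c\<leftarrow>cs. fib c)"
      by (induction cs) (simp_all add: fib_shift algebra_simps)
    then show ?thesis using floor_shift[OF that] by simp
  qed
  show ?thesis
  proof
    assume ?lhs
    then obtain ds where ds: "ds \<noteq> []" "spaced (j + 2) ds" "m = (\<Sum>d\<leftarrow>ds. fib d)" by blast
    define cs where "cs = map (\<lambda>d. d - j) ds"
    have cs: "ds = map (\<lambda>c. c + j) cs"
      unfolding cs_def map_map by (rule map_idI[symmetric]) (use spaced_ge[OF ds(2)] in fastforce)
    have sp: "spaced 2 cs" using ds(2) spaced_map_add[of 2 j cs] by (simp add: cs add.commute)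
    have z: "is_zeckendorf cs (\<Sum>c\<leftarrow>cs. fib c)"
      using sp ds(1) by (simp add: is_zeckendorf_iff_spaced cs)
    have "(\<Sum>c\<leftarrow>cs. fib c) \<ge> 1"
      using is_zeckendorf_last[OF z] fib_neq_0_nat[of "last cs"] by simp
    then show ?rhs
      using value_shift[OF sp] ds(3) unfolding cs
      by (intro exI[of _ "int (\<Sum>c\<leftarrow>cs. fib c)"]) simp
  next
    assume ?rhs
    then obtain k :: int where k: "k \<ge> 1"
      "int m = int (fib j) * \<lfloor>(real_of_int k + 1) / phi\<rfloor> + int (fib (j + 1)) * k" by blast
    then obtain cs where "is_zeckendorf cs (nat k)"
      using is_zeckendorf_exists[of "nat k"] by auto
    then have cs: "cs \<noteq> []" "spaced 2 cs" "k = int (\<Sum>c\<leftarrow>cs. fib c)"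
      using k(1) by (auto simp: is_zeckendorf_iff_spaced)
    have "int m = int (\<Sum>c\<leftarrow>map (\<lambda>c. c + j) cs. fib c)"
      using k(2) value_shift[OF cs(2)] unfolding cs(3) by simp
    then have "m = (\<Sum>c\<leftarrow>map (\<lambda>c. c + j) cs. fib c)" by linarith
    then show ?lhs
      using cs(1,2) spaced_map_add[of 2 j cs]
      by (intro exI[of _ "map (\<lambda>c. c + j) cs"]) (simp add: add.commute)
  qed
qed

section \<open>The sets of increase and decrease\<close>

lemma mem_S\<^sub>1_iff:
  "int n \<in> S\<^sub>1 \<longleftrightarrow> (\<exists>ds. ds \<noteq> [] \<and> spaced 4 ds \<and> n = (\<Sum>d\<leftarrow>ds. fib d))"
proof -
  have "fib 3 = 2" by (simp add: eval_nat_numeral)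
  then show ?thesis
    using spaced_fib_sum_iff_floor[of 2 n] by (auto simp: S\<^sub>1_def)
qed

lemma mem_S\<^sub>2_iff:
  "int n \<in> S\<^sub>2 \<longleftrightarrow> (\<exists>ds. ds \<noteq> [] \<and> spaced 5 ds \<and> n + 1 = (\<Sum>d\<leftarrow>ds. fib d))"
proof -
  have "fib 3 = 2" "fib 4 = 3" by (simp_all add: eval_nat_numeral)
  then show ?thesis
    using spaced_fib_sum_iff_floor[of 3 "n + 1"] by (auto simp: S\<^sub>2_def algebra_simps)
qed

theorem theorem1p2:
  fixes n :: nat
  assumes "n > 0"
  shows "(L n < L (n + 1) \<longleftrightarrow> int n \<in> S\<^sub>1) \<and> (L n > L (n + 1) \<longleftrightarrow> int n \<in> S\<^sub>2)"
proof -
  obtain c cs where z: "is_zeckendorf (c # cs) (n + 1)"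
    using is_zeckendorf_exists[of "n + 1"] is_zeckendorf_Nil
    by (metis add_gr_0 list.exhaust zero_less_one)
  then have c: "2 \<le> c" "spaced (c + 2) cs" "n + 1 = fib c + (\<Sum>d\<leftarrow>cs. fib d)"
    by (auto simp: is_zeckendorf_iff_spaced)
  have "int n \<in> S\<^sub>1 \<longleftrightarrow> c = 2"
  proof
    assume "int n \<in> S\<^sub>1"
    then obtain ds where "spaced 4 ds" "n = (\<Sum>d\<leftarrow>ds. fib d)" by (auto simp: mem_S\<^sub>1_iff)
    then have "is_zeckendorf (2 # ds) (n + 1)" by (simp add: is_zeckendorf_iff_spaced)
    then show "c = 2" using is_zeckendorf_unique[OF z] by auto
  next
    assume "c = 2"
    then show "int n \<in> S\<^sub>1"
      using c assms unfolding mem_S\<^sub>1_iff by (intro exI[of _ cs]) auto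
  qed
  moreover have "int n \<in> S\<^sub>2 \<longleftrightarrow> 5 \<le> c"
  proof
    assume "int n \<in> S\<^sub>2"
    then obtain ds where ds: "ds \<noteq> []" "spaced 5 ds" "n + 1 = (\<Sum>d\<leftarrow>ds. fib d)"
      unfolding mem_S\<^sub>2_iff by blast
    then have "is_zeckendorf ds (n + 1)"
      using spaced_mono[of 5 ds 2] by (simp add: is_zeckendorf_iff_spaced)
    then have "ds = c # cs" using is_zeckendorf_unique z by blast
    then show "5 \<le> c" using ds(2) by simp
  next
    assume "5 \<le> c"
    then show "int n \<in> S\<^sub>2"
      using c unfolding mem_S\<^sub>2_iff by (intro exI[of _ "c # cs"]) simp
  qed
  moreover have "L n + 1 = L (n + 1) + (c - 1) div 2"
    by (rule L_pred[OF assms z])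
  \<comment> \<open>The quotient \<open>(c - 1) div 2\<close> is 0 for \<open>c = 2\<close>, 1 for \<open>c \<in> {3, 4}\<close> and at least 2 beyond.\<close>
  ultimately show ?thesis using c(1) by (simp; linarith)
qed

end
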